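(* Let $f : (0,1) \times \mathbb{R} \to \mathbb{R}$ be continuous, and consider the second-order boundary value problem $$-u''(t) = f(t, u(t)), \quad t \in (0,1), \qquad u(0) = u(1) = 0.$$ Let $X = C[0,1]$ be equipped with the perturbed metric $$D(u_1, u_2) = \sup_{t\in[0,1]} |u_1(t) - u_2(t)| + |u_1(0) - u_2(0)|, \quad u_1, u_2 \in X,$$ with respect to the perturbed mapping $P(u_1, u_2) = |u_1(0) - u_2(0)|$. Suppose that there is $\tau > 0$ such that $$|f(s, u_1(s)) - f(s, u_2(s))| \le \exp(-\tau) \cdot |u_1(s) - u_2(s)|$$ for all $u_1, u_2 \in X$ and all $s \in (0,1)$. Then the boundary value problem has a unique solution.
   Context: $C[0,1]$ is the set of all real-valued continuous functions on $[0,1]$; solutions of the boundary value problem are sought in $X = C[0,1]$. Perturbed metric space: for mappings $D, P : X \times X \to [0,\infty)$, $D$ is a perturbed metric on $X$ with respect to $P$ if $d = D - P$ is a metric on $X$ (called the exact metric). Here the exact metric is $d(u_1,u_2) = \sup_{t\in[0,1]} |u_1(t) - u_2(t)|$. The paper regards the boundary value problem as equivalent to the integral equation $u(t) = \int_0^1 G(t,s) f(s,u(s))\, ds$, where $G$ is the Green's function $G(t,s) = s(1-t)$ for $0 < s \le t \le 1$ and $G(t,s) = t(1-s)$ for $0 < t < s \le 1$.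
   Formalization: Adds the assumption that the integral of G(t,s) f(s,u(s)) over (0,1) exists for every u in C[0,1] and t in [0,1]; without it the claim fails, e.g. for f(s,x) = 1/s^3, where no solution is continuous at 0. *)

theory Defs
  imports "HOL-Analysis.Analysis"
begin

text \<open>
  A function on \<open>[0,1]\<close> is represented by its extension that is \<open>undefined\<close> outside \<open>[0,1]\<close>,
  so that equality in \<open>C01\<close> is equality of functions on \<open>[0,1]\<close>.
\<close>

definition C01 :: "(real \<Rightarrow> real) set" where
  "C01 = {u \<in> extensional {0..1}. continuous_on {0..1} u}"

text \<open>
  \<open>Metric_space\<close> demands nonnegativity and symmetry on the whole type; \<open>D - P\<close> is
  constrained on \<open>X\<close> only, hence the default value 0 off \<open>X\<close>.
\<close>

definition perturbed_metric_on :: "'a set \<Rightarrow> ('a \<Rightarrow> 'a \<Rightarrow> real) \<Rightarrow> ('a \<Rightarrow> 'a \<Rightarrow> real) \<Rightarrow> bool" where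
  "perturbed_metric_on X D P \<longleftrightarrow>
     (\<forall>x\<in>X. \<forall>y\<in>X. 0 \<le> D x y) \<and>
     (\<forall>x\<in>X. \<forall>y\<in>X. 0 \<le> P x y) \<and>
     Metric_space X (\<lambda>x y. if x \<in> X \<and> y \<in> X then D x y - P x y else 0)"

definition D01 :: "(real \<Rightarrow> real) \<Rightarrow> (real \<Rightarrow> real) \<Rightarrow> real" where
  "D01 u1 u2 = (SUP t\<in>{0..1}. \<bar>u1 t - u2 t\<bar>) + \<bar>u1 0 - u2 0\<bar>"

definition P01 :: "(real \<Rightarrow> real) \<Rightarrow> (real \<Rightarrow> real) \<Rightarrow> real" where
  "P01 u1 u2 = \<bar>u1 0 - u2 0\<bar>"

lemma bdd_above_C01_diff:
  assumes "u \<in> C01" "v \<in> C01"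
  shows "bdd_above ((\<lambda>t. \<bar>u t - v t\<bar>) ` {0..1})"
proof -
  have "continuous_on {0..1} (\<lambda>t. \<bar>u t - v t\<bar>)"
    using assms by (auto simp: C01_def intro!: continuous_intros)
  then show ?thesis
    by (intro bounded_imp_bdd_above compact_imp_bounded compact_continuous_image) auto
qed

lemma C01_diff_le_SUP:
  assumes "u \<in> C01" "v \<in> C01" "t \<in> {0..1}"
  shows "\<bar>u t - v t\<bar> \<le> (SUP t\<in>{0..1}. \<bar>u t - v t\<bar>)"
  using assms by (intro cSUP_upper bdd_above_C01_diff)

lemma perturbed_metric_on_C01: "perturbed_metric_on C01 D01 P01"
proof -
  let ?d = "\<lambda>u v. SUP t\<in>{0..1}. \<bar>u t - v t :: real\<bar>"
  have nonneg: "0 \<le> ?d u v" if "u \<in> C01" "v \<in> C01" for u v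
    using C01_diff_le_SUP[OF that, of 0] by simp
  have zero: "?d u v = 0 \<longleftrightarrow> u = v" if "u \<in> C01" "v \<in> C01" for u v
  proof
    assume "?d u v = 0"
    then have "u t = v t" if "t \<in> {0..1}" for t
      using C01_diff_le_SUP[OF \<open>u \<in> C01\<close> \<open>v \<in> C01\<close> that] by simp
    then show "u = v"
      using that by (intro extensionalityI[of u "{0..1}" v]) (auto simp: C01_def)
  qed simp
  have triangle: "?d u w \<le> ?d u v + ?d v w" if "u \<in> C01" "v \<in> C01" "w \<in> C01" for u v w
  proof (rule cSUP_least)
    fix t :: real assume t: "t \<in> {0..1}"
    show "\<bar>u t - w t\<bar> \<le> ?d u v + ?d v w"
      using C01_diff_le_SUP[OF that(1,2) t] C01_diff_le_SUP[OF that(2,3) t] by linarith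
  qed simp
  have "Metric_space C01 (\<lambda>u v. if u \<in> C01 \<and> v \<in> C01 then D01 u v - P01 u v else 0)"
    by unfold_locales
      (simp_all add: D01_def P01_def nonneg zero triangle abs_minus_commute)
  then show ?thesis
    by (auto simp: perturbed_metric_on_def D01_def P01_def nonneg)
qed

definition green :: "real \<Rightarrow> real \<Rightarrow> real" where
  "green t s = (if s \<le> t then s * (1 - t) else t * (1 - s))"

definition bvp_solution :: "(real \<times> real \<Rightarrow> real) \<Rightarrow> (real \<Rightarrow> real) \<Rightarrow> bool" where
  "bvp_solution f u \<longleftrightarrow>
     u \<in> C01 \<and>
     (\<exists>u' u''. \<forall>t\<in>{0<..<1}.
        (u has_real_derivative u' t) (at t) \<and>
        (u' has_real_derivative u'' t) (at t) \<and>
        - u'' t = f (t, u t)) \<and>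
     u 0 = 0 \<and> u 1 = 0"

text \<open>
  Since \<open>f\<close> need only be continuous on the open strip \<open>(0,1) \<times> \<real>\<close>, the integral
  \<open>\<integral>\<^sub>0\<^sup>1 G(t,s) f(s,u(s)) ds\<close> may diverge: for \<open>f(s,x) = 1/s\<^sup>3\<close> every solution of
  \<open>-u'' = f\<close> is unbounded near 0. That the integral equation equivalent to the boundary value
  problem makes sense on \<open>C[0,1]\<close> is therefore expressed as a condition on \<open>f\<close>.
\<close>

definition green_integrable :: "(real \<times> real \<Rightarrow> real) \<Rightarrow> bool" where
  "green_integrable f \<longleftrightarrow>
     (\<forall>u\<in>C01. \<forall>t\<in>{0..1}. (\<lambda>s. green t s * f (s, u s)) integrable_on {0<..<1})"

end

theory Submission
  imports Defs
begin

text \<open>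
  A function in \<open>C[0,1]\<close> solves the boundary value problem iff it is a fixed point of
  \<open>(T u)(t) = \<integral>\<^sub>0\<^sup>1 G(t,s) f(s,u(s)) ds\<close>: a solution and its image under \<open>T\<close> have the same second
  derivative, so they differ by an affine function, which vanishes at both ends. As
  \<open>0 \<le> G \<le> 1\<close>, the Lipschitz condition makes \<open>T\<close> a contraction with constant \<open>exp (- \<tau>) < 1\<close> in the
  supremum distance. The delicate point is that \<open>T u\<close> is continuous at the ends of \<open>[0,1]\<close>, since
  the integral is only a Henstock--Kurzweil integral.
\<close>

section \<open>The Green operator and its splitting at t\<close>

text \<open>The solution operator of the linear problem -w'' = \<phi>, w(0) = w(1) = 0; the map T
  sends u to \<open>green_op (\<lambda>s. f (s, u s))\<close>.\<close>

definition green_op :: "(real \<Rightarrow> real) \<Rightarrow> real \<Rightarrow> real" where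
  "green_op \<phi> t = integral {0..1} (\<lambda>s. green t s * \<phi> s)"

text \<open>What a frozen right-hand side \<phi>(s) = f(s, u(s)) inherits from f. As \<phi> may be
  unbounded near 0 and 1, integrability is asked only of its product with the kernel.\<close>

definition green_admissible :: "(real \<Rightarrow> real) \<Rightarrow> bool" where
  "green_admissible \<phi> \<longleftrightarrow>
     continuous_on {0<..<1} \<phi> \<and>
     (\<forall>t\<in>{0..1}. (\<lambda>s. green t s * \<phi> s) integrable_on {0..1})"

lemma green_bounds:
  assumes "t \<in> {0..1}" "s \<in> {0..1}"
  shows "0 \<le> green t s" "green t s \<le> 1"
  using assms by (auto simp: green_def mult_le_one)

text \<open>Symmetry about 1/2, through which behaviour at the end 1 follows from that at 0. At s =
  t the two branches of \<open>green\<close> agree.\<close>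

lemma green_reflect: "green (1 - t) (1 - s) = green t s"
  by (auto simp: green_def)

lemma green_op_at_ends: "green_op \<phi> 0 = 0" "green_op \<phi> 1 = 0"
  unfolding green_op_def by (intro integral_unique has_integral_is_0; simp add: green_def)+

text \<open>On [0,t] the kernel is s times the constant 1 - t, which is nonzero for t < 1 and can be
  divided out.\<close>

lemma green_admissible_integrable_left:
  assumes "green_admissible \<phi>" "0 \<le> t" "t < 1"
  shows "(\<lambda>s. s * \<phi> s) integrable_on {0..t}"
proof -
  have "(\<lambda>s. green t s * \<phi> s) integrable_on {0..t}"
    using assms integrable_on_subinterval[of "\<lambda>s. green t s * \<phi> s" "{0..1}" 0 t]
    by (auto simp: green_admissible_def)
  then have "(\<lambda>s. (1 - t) * (s * \<phi> s)) integrable_on {0..t}"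
    by (rule integrable_eq) (auto simp: green_def)
  then show ?thesis
    using assms integrable_on_cmult_iff[of "1 - t" "\<lambda>s. s * \<phi> s" "{0..t}"] by simp
qed

lemma green_admissible_integrable_right:
  assumes "green_admissible \<phi>" "0 < t" "t \<le> 1"
  shows "(\<lambda>s. (1 - s) * \<phi> s) integrable_on {t..1}"
proof -
  have "(\<lambda>s. green t s * \<phi> s) integrable_on {t..1}"
    using assms integrable_on_subinterval[of "\<lambda>s. green t s * \<phi> s" "{0..1}" t 1]
    by (auto simp: green_admissible_def)
  then have "(\<lambda>s. t * ((1 - s) * \<phi> s)) integrable_on {t..1}"
    by (rule integrable_eq) (auto simp: green_def)
  then show ?thesis
    using assms integrable_on_cmult_iff[of t "\<lambda>s. (1 - s) * \<phi> s" "{t..1}"] by simp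
qed

text \<open>Here t is left only in outer factors and integration limits, so that the product rule
  and the fundamental theorem apply.\<close>

lemma green_op_split:
  assumes "green_admissible \<phi>" "0 < t" "t < 1"
  shows "green_op \<phi> t =
    (1 - t) * integral {0..t} (\<lambda>s. s * \<phi> s) + t * integral {t..1} (\<lambda>s. (1 - s) * \<phi> s)"
proof -
  have "green_op \<phi> t = integral {0..t} (\<lambda>s. green t s * \<phi> s) + integral {t..1} (\<lambda>s. green t s * \<phi> s)"
    unfolding green_op_def using assms
    by (intro Henstock_Kurzweil_Integration.integral_combine[symmetric]) (auto simp: green_admissible_def)
  also have "integral {0..t} (\<lambda>s. green t s * \<phi> s) = integral {0..t} (\<lambda>s. (1 - t) * (s * \<phi> s))"
    by (intro Henstock_Kurzweil_Integration.integral_cong) (auto simp: green_def)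
  also have "integral {t..1} (\<lambda>s. green t s * \<phi> s) = integral {t..1} (\<lambda>s. t * ((1 - s) * \<phi> s))"
    by (intro Henstock_Kurzweil_Integration.integral_cong) (auto simp: green_def)
  finally show ?thesis by simp
qed

section \<open>Derivatives in the open interval\<close>

text \<open>The fundamental theorem of calculus at a single point of continuity. The moving lower
  limit follows by subtracting from the integral over the whole interval.\<close>

lemma integral_has_real_derivative_interior:
  fixes g :: "real \<Rightarrow> real"
  assumes "g integrable_on {a..b}" "a < t" "t < b" "isCont g t"
  shows "((\<lambda>u. integral {a..u} g) has_real_derivative g t) (at t)"
    and "((\<lambda>u. integral {u..b} g) has_real_derivative - g t) (at t)"
proof -
  have "((\<lambda>u. integral {a..u} g) has_vector_derivative g t) (at t within {a..b})"
    using integral_has_vector_derivative_continuous_at[of g a b t "{}"] assms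
    by (auto intro: continuous_within_subset)
  then show *: "((\<lambda>u. integral {a..u} g) has_real_derivative g t) (at t)"
    using assms by (simp add: has_real_derivative_iff_has_vector_derivative at_within_Icc_at)
  have "((\<lambda>u. integral {a..b} g - integral {a..u} g) has_real_derivative - g t) (at t)"
    by (auto intro!: derivative_eq_intros *)
  then show "((\<lambda>u. integral {u..b} g) has_real_derivative - g t) (at t)"
  proof (rule has_field_derivative_transform_within_open)
    show "integral {a..b} g - integral {a..u} g = integral {u..b} g" if "u \<in> {a<..<b}" for u
      using Henstock_Kurzweil_Integration.integral_combine[of a u b g] that assms by simp
  qed (use assms in auto)
qed

text \<open>With A and B the two integrals of the splitting, the terms from differentiating the
  limits cancel in the first derivative, leaving p = B - A. Then p' = -(1 - t) \<phi>(t) - t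
  \<phi>(t) = -\<phi>(t).\<close>

lemma green_op_second_derivative:
  assumes "green_admissible \<phi>"
  obtains p where "\<And>t. t \<in> {0<..<1} \<Longrightarrow> (green_op \<phi> has_real_derivative p t) (at t)"
    and "\<And>t. t \<in> {0<..<1} \<Longrightarrow> (p has_real_derivative - \<phi> t) (at t)"
proof -
  define A where "A t = integral {0..t} (\<lambda>s. s * \<phi> s)" for t
  define B where "B t = integral {t..1} (\<lambda>s. (1 - s) * \<phi> s)" for t
  have cont: "isCont \<phi> t" if "t \<in> {0<..<1}" for t
    using assms that continuous_on_eq_continuous_at[of "{0<..<1}" \<phi>]
    by (auto simp: green_admissible_def)
  have A: "(A has_real_derivative t * \<phi> t) (at t)" if t: "t \<in> {0<..<1}" for t
    unfolding A_def
  proof (rule integral_has_real_derivative_interior(1))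
    \<comment> \<open>Integrability is known only short of 1; the midpoint of t and 1 makes t
      interior to the interval. Dually, t / 2 serves for B.\<close>
    show "(\<lambda>s. s * \<phi> s) integrable_on {0..(t + 1) / 2}"
      using assms t by (intro green_admissible_integrable_left) auto
  qed (use t cont in \<open>auto intro!: continuous_intros\<close>)
  have B: "(B has_real_derivative - ((1 - t) * \<phi> t)) (at t)" if t: "t \<in> {0<..<1}" for t
    unfolding B_def
  proof (rule integral_has_real_derivative_interior(2))
    show "(\<lambda>s. (1 - s) * \<phi> s) integrable_on {t / 2..1}"
      using assms t by (intro green_admissible_integrable_right) auto
  qed (use t cont in \<open>auto intro!: continuous_intros\<close>)
  show ?thesis
  proof (rule that)
    fix t :: real assume t: "t \<in> {0<..<1}"
    have "((\<lambda>t. (1 - t) * A t + t * B t) has_real_derivative B t - A t) (at t)"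
      by (rule derivative_eq_intros A B t refl | simp add: algebra_simps)+
    then show "(green_op \<phi> has_real_derivative B t - A t) (at t)"
    proof (rule has_field_derivative_transform_within_open)
      show "(1 - u) * A u + u * B u = green_op \<phi> u" if "u \<in> {0<..<1}" for u
        using that assms by (simp add: green_op_split A_def B_def)
    qed (use t in auto)
    show "((\<lambda>t. B t - A t) has_real_derivative - \<phi> t) (at t)"
      by (rule derivative_eq_intros A B t refl | simp add: algebra_simps)+
  qed
qed

section \<open>Continuity up to the boundary\<close>

text \<open>
  The integrand \<open>green t s * \<phi> s\<close> need not be absolutely integrable near 0, so no dominated
  convergence is available. The second mean value theorem, applied to
  \<open>t (1 - s) \<phi> s = (t (1 - s) / s) (s \<phi> s)\<close> with its monotone first factor, replaces it.
\<close>

lemma green_op_tendsto_0_at_right: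
  assumes "green_admissible \<phi>"
  shows "(green_op \<phi> \<longlongrightarrow> 0) (at_right 0)"
proof (rule tendstoI)
  fix e :: real assume "e > 0"
  define \<psi> where "\<psi> = (\<lambda>s. s * \<phi> s)"
  define A where "A t = integral {0..t} \<psi>" for t
  define B where "B t = integral {t..1} (\<lambda>s. (1 - s) * \<phi> s)" for t
  \<comment> \<open>The bound to come is 5 d plus a term vanishing with t, and 5 d = 5 e / 12 <
    e.\<close>
  define d where "d = e / 12"
  have "d > 0" using \<open>e > 0\<close> by (simp add: d_def)
  have \<psi>: "\<psi> integrable_on {0..t}" if "0 \<le> t" "t < 1" for t
    unfolding \<psi>_def using assms that by (rule green_admissible_integrable_left)
  have "continuous_on {0..1/2} A"
    unfolding A_def by (intro indefinite_integral_continuous_1 \<psi>) auto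
  then obtain r where r: "r > 0" "\<And>x. x \<in> {0..1/2} \<Longrightarrow> dist x 0 < r \<Longrightarrow> dist (A x) (A 0) < d"
    unfolding continuous_on_iff using \<open>d > 0\<close>
    by (metis atLeastAtMost_iff order_refl zero_le_divide_1_iff zero_le_numeral)
  \<comment> \<open>Halving r gives c < r, so A is small on all of the closed interval [0,c]; the
    cap 1/2 stays within the range of continuity.\<close>
  define c where "c = min (r / 2) (1 / 2)"
  have c: "0 < c" "c \<le> 1 / 2" using \<open>r > 0\<close> by (auto simp: c_def)
  have A_small: "\<bar>A x\<bar> \<le> d" if "0 \<le> x" "x \<le> c" for x
    using r(2)[of x] that r(1) c by (auto simp: c_def A_def dist_real_def)
  have \<psi>_small: "\<bar>integral {x..y} \<psi>\<bar> \<le> 2 * d" if "0 \<le> x" "x \<le> y" "y \<le> c" for x y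
    using Henstock_Kurzweil_Integration.integral_combine[of 0 x y \<psi>] \<psi>[of y] that c A_small[of x] A_small[of y]
    by (simp add: A_def)
  \<comment> \<open>One d comes from (1 - t) A(t), and 2 d from each of the two mean value terms on
    [t,c]; the tail beyond c is fixed and carries the factor t.\<close>
  have bound: "\<bar>green_op \<phi> t\<bar> \<le> 5 * d + t * \<bar>B c\<bar>" if t: "0 < t" "t < c" for t
  proof -
    \<comment> \<open>The minus sign makes the factor increasing, as the mean value theorem
      requires; (1 - s) \<phi>(s) = -g(s) \<psi>(s).\<close>
    define g where "g s = - ((1 - s) / s)" for s :: real
    have g_mono: "g x \<le> g y" if "t \<le> x" "x \<le> y" "y \<le> c" for x y
      using that t by (simp add: g_def field_simps)
    have "\<psi> integrable_on {t..c}"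
      using t c by (intro integrable_on_subinterval[OF \<psi>[of c]]) auto
    then obtain x where x: "x \<in> {t..c}"
      and eq: "integral {t..c} (\<lambda>s. g s * \<psi> s) =
        g t * integral {t..x} \<psi> + g c * integral {x..c} \<psi>"
      by (rule second_mean_value_theorem[where g = g]) (use g_mono t in auto)
    have "integral {t..c} (\<lambda>s. (1 - s) * \<phi> s) = integral {t..c} (\<lambda>s. - (g s * \<psi> s))"
      using t by (intro Henstock_Kurzweil_Integration.integral_cong) (auto simp: g_def \<psi>_def)
    \<comment> \<open>The outer factor t tames the blow-up of g at 0: the weights become 1 - t and t
      (1 - c) / c, both at most 1 because t < c.\<close>
    then have mid: "t * integral {t..c} (\<lambda>s. (1 - s) * \<phi> s) =
        (1 - t) * integral {t..x} \<psi> + (t * (1 - c) / c) * integral {x..c} \<psi>"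
      using eq t c by (simp add: g_def field_simps)
    have "\<bar>(1 - t) * integral {t..x} \<psi>\<bar> \<le> 1 * (2 * d)"
      unfolding abs_mult using t c x by (intro mult_mono \<psi>_small) auto
    moreover have "\<bar>(t * (1 - c) / c) * integral {x..c} \<psi>\<bar> \<le> 1 * (2 * d)"
      unfolding abs_mult
    proof (intro mult_mono \<psi>_small)
      have "t * (1 - c) \<le> c * 1" using t c by (intro mult_mono) auto
      then show "\<bar>t * (1 - c) / c\<bar> \<le> 1" using t c by (simp add: abs_mult)
    qed (use t c x in auto)
    moreover have "\<bar>(1 - t) * A t\<bar> \<le> 1 * d"
      unfolding abs_mult using t c by (intro mult_mono A_small) auto
    moreover have "B t = integral {t..c} (\<lambda>s. (1 - s) * \<phi> s) + B c"
      unfolding B_def using t c assms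
      by (intro Henstock_Kurzweil_Integration.integral_combine[symmetric] green_admissible_integrable_right) auto
    moreover have "green_op \<phi> t = (1 - t) * A t + t * B t"
      using green_op_split[of \<phi> t] assms t c by (simp add: A_def B_def \<psi>_def)
    moreover have "\<bar>t * B c\<bar> = t * \<bar>B c\<bar>" using t by (simp add: abs_mult)
    ultimately show ?thesis using mid by (simp only: distrib_left)
  qed
  have "((\<lambda>t. 5 * d + t * \<bar>B c\<bar>) \<longlongrightarrow> 5 * d + 0 * \<bar>B c\<bar>) (at_right 0)"
    by (intro tendsto_intros)
  then have "\<forall>\<^sub>F t in at_right 0. 5 * d + t * \<bar>B c\<bar> < e"
    by (rule order_tendstoD(2)) (use \<open>e > 0\<close> in \<open>simp add: d_def\<close>)
  moreover have "\<forall>\<^sub>F t in at_right 0. t \<in> {0<..<c}"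
    using c by (intro eventually_at_right_real)
  ultimately show "\<forall>\<^sub>F t in at_right 0. dist (green_op \<phi> t) 0 < e"
    by eventually_elim (use bound in fastforce)
qed

lemma has_integral_reflect_unit:
  fixes g :: "real \<Rightarrow> real"
  assumes "(g has_integral i) {0..1}"
  shows "((\<lambda>s. g (1 - s)) has_integral i) {0..1}"
proof -
  have "(\<lambda>s::real. 1 - s) ` {0..1} = {0..1}"
    by (auto simp: image_iff intro!: bexI[of _ "1 - _"])
  then show ?thesis
    using has_integral_affinity01[OF assms, of "-1" 1] by simp
qed

text \<open>Substitute 1 - s for s and use the symmetry \<open>green_reflect\<close>.\<close>

lemma green_op_reflect:
  assumes "green_admissible \<phi>"
  shows "green_admissible (\<lambda>s. \<phi> (1 - s))"
    and "t \<in> {0..1} \<Longrightarrow> green_op (\<lambda>s. \<phi> (1 - s)) t = green_op \<phi> (1 - t)"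
proof -
  have *: "((\<lambda>s. green t s * \<phi> (1 - s)) has_integral green_op \<phi> (1 - t)) {0..1}"
    if "t \<in> {0..1}" for t
  proof -
    have "((\<lambda>s. green (1 - t) s * \<phi> s) has_integral green_op \<phi> (1 - t)) {0..1}"
      unfolding green_op_def using assms that
      by (intro integrable_integral) (auto simp: green_admissible_def)
    from has_integral_reflect_unit[OF this] show ?thesis by (simp add: green_reflect)
  qed
  have "continuous_on {0<..<1} (\<lambda>s. \<phi> (1 - s))"
    using assms unfolding green_admissible_def
    by (auto intro!: continuous_on_compose2[of "{0<..<1}" \<phi>] continuous_intros)
  then show "green_admissible (\<lambda>s. \<phi> (1 - s))"
    unfolding green_admissible_def using * by (blast intro: has_integral_integrable)
  show "green_op (\<lambda>s. \<phi> (1 - s)) t = green_op \<phi> (1 - t)" if "t \<in> {0..1}"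
    using *[OF that] unfolding green_op_def[of _ t] by (rule integral_unique)
qed

text \<open>Interior points are covered by differentiability, the end 0 by the limit just shown, and
  the end 1 by the same limit for the reflected right-hand side.\<close>

lemma continuous_on_green_op:
  assumes "green_admissible \<phi>"
  shows "continuous_on {0..1} (green_op \<phi>)"
proof (rule continuous_on_IccI)
  show "(green_op \<phi> \<longlongrightarrow> green_op \<phi> 0) (at_right 0)"
    using green_op_tendsto_0_at_right[OF assms] by (simp add: green_op_at_ends)
  have near1: "\<forall>\<^sub>F t in at_left (1::real). t \<in> {0<..<1}"
    by (intro eventually_at_left_real) simp
  have "filterlim (\<lambda>t::real. 1 - t) (at_right 0) (at_left 1)"
    unfolding filterlim_at
  proof
    show "\<forall>\<^sub>F t in at_left (1::real). 1 - t \<in> {0<..} \<and> 1 - t \<noteq> 0"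
      using near1 by eventually_elim auto
  qed (auto intro!: tendsto_eq_intros)
  then have "((\<lambda>t. green_op (\<lambda>s. \<phi> (1 - s)) (1 - t)) \<longlongrightarrow> 0) (at_left 1)"
    by (intro filterlim_compose[OF green_op_tendsto_0_at_right] green_op_reflect assms)
  moreover have "\<forall>\<^sub>F t in at_left 1. green_op (\<lambda>s. \<phi> (1 - s)) (1 - t) = green_op \<phi> t"
    using near1 by eventually_elim (simp add: green_op_reflect(2)[OF assms])
  ultimately show "(green_op \<phi> \<longlongrightarrow> green_op \<phi> 1) (at_left 1)"
    unfolding green_op_at_ends by (rule Lim_transform_eventually)
  show "(green_op \<phi> \<longlongrightarrow> green_op \<phi> t) (at t)" if "0 < t" "t < 1" for t
    using green_op_second_derivative[OF assms] that
    by (metis DERIV_isCont greaterThanLessThan_iff isCont_def)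
qed simp

section \<open>Uniqueness for the linear problem\<close>

text \<open>The derivatives of u and \<open>green_op \<phi>\<close> differ by a constant c, so u -
  \<open>green_op \<phi>\<close> - c t is constant, up to the ends by continuity. It is 0 at 0 and
  -c at 1, whence c = 0.\<close>

lemma eq_green_op_of_second_derivative:
  assumes adm: "green_admissible \<phi>"
    and cont: "continuous_on {0..1} u" and ends: "u 0 = 0" "u 1 = 0"
    and u': "\<And>t. t \<in> {0<..<1} \<Longrightarrow> (u has_real_derivative u' t) (at t)"
    and u'': "\<And>t. t \<in> {0<..<1} \<Longrightarrow> (u' has_real_derivative - \<phi> t) (at t)"
    and t: "t \<in> {0..1}"
  shows "u t = green_op \<phi> t"
proof -
  obtain p where p: "\<And>t. t \<in> {0<..<1} \<Longrightarrow> (green_op \<phi> has_real_derivative p t) (at t)"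
    and p': "\<And>t. t \<in> {0<..<1} \<Longrightarrow> (p has_real_derivative - \<phi> t) (at t)"
    using green_op_second_derivative[OF adm] by blast
  define c where "c = u' (1/2) - p (1/2)"
  have c: "u' s - p s = c" if "s \<in> {0<..<1}" for s
    unfolding c_def
  proof (rule DERIV_isconst3[where a = 0 and b = 1 and f = "\<lambda>s. u' s - p s"])
    fix x :: real assume "x \<in> {0<..<1}"
    then show "((\<lambda>s. u' s - p s) has_real_derivative 0) (at x)"
      by (auto intro!: derivative_eq_intros u'' p')
  qed (use that in auto)
  define w where "w s = u s - green_op \<phi> s - c * s" for s
  have w: "w s = w 0" if "s \<in> {0..1}" for s
  proof (rule DERIV_isconst2[where a = 0 and b = 1 and f = w])
    show "continuous_on {0..1} w"
      unfolding w_def by (intro continuous_intros cont continuous_on_green_op adm)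
    fix x :: real assume "0 < x" "x < 1"
    then have x: "x \<in> {0<..<1}" by simp
    show "(w has_real_derivative 0) (at x)"
      unfolding w_def using c[OF x]
      by (auto intro!: derivative_eq_intros u'[OF x] p[OF x])
  qed (use that in auto)
  have "c = 0" using w[of 1] by (simp add: w_def ends green_op_at_ends)
  then show ?thesis using w[OF t] by (simp add: w_def ends green_op_at_ends)
qed

section \<open>The contraction estimate\<close>

lemma green_op_cong:
  assumes "\<And>s. s \<in> {0<..<1} \<Longrightarrow> \<phi> s = \<psi> s"
  shows "green_op \<phi> t = green_op \<psi> t"
  unfolding green_op_def by (rule integral_spike[of "{0, 1}"]) (use assms in auto)

text \<open>The kernel lies between 0 and 1 and the interval has length 1. The ends, where no bound
  on the difference is assumed, form a negligible set.\<close>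

lemma green_op_diff_le:
  assumes "green_admissible \<phi>" "green_admissible \<psi>" "t \<in> {0..1}" "0 \<le> M"
    and le: "\<And>s. s \<in> {0<..<1} \<Longrightarrow> \<bar>\<phi> s - \<psi> s\<bar> \<le> M"
  shows "\<bar>green_op \<phi> t - green_op \<psi> t\<bar> \<le> M"
proof -
  have "((\<lambda>s. green t s * \<phi> s - green t s * \<psi> s) has_integral green_op \<phi> t - green_op \<psi> t) {0..1}"
    unfolding green_op_def using assms
    by (intro has_integral_diff integrable_integral) (auto simp: green_admissible_def)
  then have "norm (green_op \<phi> t - green_op \<psi> t) \<le> M * measure lborel {0..1 :: real}"
  proof (rule has_integral_bound_real[OF \<open>0 \<le> M\<close>, of "{0, 1}", rotated])
    fix s :: real assume s: "s \<in> {0..1} - {0, 1}"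
    have "\<bar>green t s\<bar> * \<bar>\<phi> s - \<psi> s\<bar> \<le> 1 * M"
      using green_bounds[OF assms(3), of s] le[of s] s by (intro mult_mono) auto
    then show "norm (green t s * \<phi> s - green t s * \<psi> s) \<le> M"
      by (simp flip: abs_mult right_diff_distrib)
  qed simp
  then show ?thesis by simp
qed

section \<open>Solutions as fixed points\<close>

lemma green_admissible_comp:
  assumes f: "continuous_on ({0<..<1} \<times> UNIV) f" and "green_integrable f"
    and u: "continuous_on {0..1} u"
  shows "green_admissible (\<lambda>s. f (s, u s))"
  unfolding green_admissible_def
proof (intro conjI ballI)
  have "continuous_on {0<..<1} (\<lambda>s. (s, u s))"
    using u by (auto intro!: continuous_intros intro: continuous_on_subset)
  then show "continuous_on {0<..<1} (\<lambda>s. f (s, u s))"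
    by (rule continuous_on_compose2[OF f]) auto
  fix t :: real assume "t \<in> {0..1}"
  \<comment> \<open>\<open>green_integrable\<close> speaks of members of \<open>C01\<close>, whereas
    u may take any values off [0,1]; restricting changes nothing on (0,1).\<close>
  moreover have "restrict u {0..1} \<in> C01"
    using u by (auto simp: C01_def cong: continuous_on_cong_simp)
  ultimately have "(\<lambda>s. green t s * f (s, restrict u {0..1} s)) integrable_on {0<..<1}"
    using assms(2) by (auto simp: green_integrable_def)
  then have "(\<lambda>s. green t s * f (s, u s)) integrable_on {0<..<1}"
    by (rule integrable_eq) auto
  then show "(\<lambda>s. green t s * f (s, u s)) integrable_on {0..1}"
    by (simp add: integrable_on_open_interval_real)
qed

text \<open>Freezing \<phi>(s) = f(s, u(s)) turns the nonlinear problem for a given u into the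
  linear one.\<close>

lemma bvp_solution_iff_green_op:
  assumes "continuous_on ({0<..<1} \<times> UNIV) f" "green_integrable f" "u \<in> C01"
  shows "bvp_solution f u \<longleftrightarrow> (\<forall>t\<in>{0..1}. u t = green_op (\<lambda>s. f (s, u s)) t)"
proof -
  have cont: "continuous_on {0..1} u" using assms(3) by (simp add: C01_def)
  note adm = green_admissible_comp[OF assms(1,2) cont]
  show ?thesis
  proof
    assume "bvp_solution f u"
    then obtain u' u'' where "u 0 = 0" "u 1 = 0"
      and D: "\<And>t. t \<in> {0<..<1} \<Longrightarrow> (u has_real_derivative u' t) (at t)"
        "\<And>t. t \<in> {0<..<1} \<Longrightarrow> (u' has_real_derivative u'' t) (at t)"
        "\<And>t. t \<in> {0<..<1} \<Longrightarrow> - u'' t = f (t, u t)"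
      unfolding bvp_solution_def by blast
    then have "(u' has_real_derivative - f (t, u t)) (at t)" if "t \<in> {0<..<1}" for t
      using that by (metis minus_minus)
    then show "\<forall>t\<in>{0..1}. u t = green_op (\<lambda>s. f (s, u s)) t"
      using eq_green_op_of_second_derivative[OF adm cont \<open>u 0 = 0\<close> \<open>u 1 = 0\<close> D(1)] by blast
  next
    assume eq: "\<forall>t\<in>{0..1}. u t = green_op (\<lambda>s. f (s, u s)) t"
    obtain p where
      p: "\<And>t. t \<in> {0<..<1} \<Longrightarrow> (green_op (\<lambda>s. f (s, u s)) has_real_derivative p t) (at t)"
      "\<And>t. t \<in> {0<..<1} \<Longrightarrow> (p has_real_derivative - f (t, u t)) (at t)"
      using green_op_second_derivative[OF adm] by blast
    have "(u has_real_derivative p t) (at t)" if "t \<in> {0<..<1}" for t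
      using p(1)[OF that] by (rule has_field_derivative_transform_within_open[of _ _ _ "{0<..<1}"])
        (use that eq in auto)
    then have "\<forall>t\<in>{0<..<1}. (u has_real_derivative p t) (at t) \<and>
        (p has_real_derivative - f (t, u t)) (at t) \<and> - (- f (t, u t)) = f (t, u t)"
      using p(2) by simp
    moreover have "u 0 = 0" "u 1 = 0" using eq green_op_at_ends by auto
    ultimately show "bvp_solution f u"
      unfolding bvp_solution_def using assms(3)
      by (intro conjI exI[of _ p] exI[of _ "\<lambda>t. - f (t, u t)"]) auto
  qed
qed

section \<open>Existence and uniqueness by contraction\<close>

theorem theorem4p1:
  fixes f :: "real \<times> real \<Rightarrow> real" and \<tau> :: real
  assumes "continuous_on ({0<..<1} \<times> UNIV) f"
    and "green_integrable f"
    and "perturbed_metric_on C01 D01 P01"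
    and "\<tau> > 0"
    and "\<And>u1 u2 s. u1 \<in> C01 \<Longrightarrow> u2 \<in> C01 \<Longrightarrow> s \<in> {0<..<1} \<Longrightarrow>
           \<bar>f (s, u1 s) - f (s, u2 s)\<bar> \<le> exp (- \<tau>) * \<bar>u1 s - u2 s\<bar>"
  shows "\<exists>!u. bvp_solution f u"
proof -
  define T where "T u = green_op (\<lambda>s. f (s, u s))" for u
  have T_cong: "T u t = T v t" if "\<And>s. s \<in> {0..1} \<Longrightarrow> u s = v s" "t \<in> {0..1}" for u v t
    unfolding T_def using that by (intro green_op_cong) auto
  \<comment> \<open>Constant functions turn the condition on pairs in \<open>C01\<close> into a
    Lipschitz condition in the second argument of f.\<close>
  have lip: "\<bar>f (s, x) - f (s, y)\<bar> \<le> exp (- \<tau>) * \<bar>x - y\<bar>" if "s \<in> {0<..<1}" for s x y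
    using assms(5)[of "restrict (\<lambda>_. x) {0..1}" "restrict (\<lambda>_. y) {0..1}" s] that
    by (auto simp: C01_def cong: continuous_on_cong_simp)
  have T_cont: "continuous_on {0..1} (T u)" if "continuous_on {0..1} u" for u
    unfolding T_def using that assms(1,2)
    by (intro continuous_on_green_op green_admissible_comp)
  have T_dist: "\<bar>T u t - T v t\<bar> \<le> exp (- \<tau>) * M"
    if "continuous_on {0..1} u" "continuous_on {0..1} v" "t \<in> {0..1}"
      and M: "\<And>s. s \<in> {0..1} \<Longrightarrow> \<bar>u s - v s\<bar> \<le> M" for u v t M
    unfolding T_def
  proof (rule green_op_diff_le)
    show "0 \<le> exp (- \<tau>) * M" using M[of 0] by simp
    show "\<bar>f (s, u s) - f (s, v s)\<bar> \<le> exp (- \<tau>) * M" if "s \<in> {0<..<1}" for s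
    proof -
      have "exp (- \<tau>) * \<bar>u s - v s\<bar> \<le> exp (- \<tau>) * M"
        using that by (intro mult_left_mono M) auto
      with lip[OF that, of "u s" "v s"] show ?thesis by linarith
    qed
  qed (use that assms(1,2) green_admissible_comp in auto)
  have bc: "continuous_on S (apply_bcontfun b)" for S and b :: "real \<Rightarrow>\<^sub>C real"
    using continuous_on_apply_bcontfun[of UNIV b] continuous_on_subset by blast
  \<comment> \<open>Banach's theorem is applied in the complete space of bounded continuous
    functions on the line; \<open>clamp\<close> extends T b from [0,1] by its end values.\<close>
  have "\<forall>b :: real \<Rightarrow>\<^sub>C real. \<exists>c :: real \<Rightarrow>\<^sub>C real. \<forall>x. c x = T b (clamp 0 1 x)"
  proof
    fix b :: "real \<Rightarrow>\<^sub>C real"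
    show "\<exists>c :: real \<Rightarrow>\<^sub>C real. \<forall>x. c x = T b (clamp 0 1 x)"
      using T_cont[OF bc, of b] by (metis box_real(2) continuous_on_cbox_bcontfunE)
  qed
  then obtain F :: "(real \<Rightarrow>\<^sub>C real) \<Rightarrow> (real \<Rightarrow>\<^sub>C real)"
    where F: "\<And>b x. F b x = T b (clamp 0 1 x)" by metis
  have clamp: "clamp 0 1 x \<in> {0..1}" for x :: real
    using clamp_in_interval[of 0 1 x] by simp
  have "\<exists>!b. F b = b"
  proof (rule banach_fix_type)
    show "0 \<le> exp (- \<tau>)" "exp (- \<tau>) < 1" using \<open>\<tau> > 0\<close> by simp_all
    show "\<forall>b c. dist (F b) (F c) \<le> exp (- \<tau>) * dist b c"
    proof (intro allI dist_bound)
      fix b c :: "real \<Rightarrow>\<^sub>C real" and x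
      have "\<bar>T b (clamp 0 1 x) - T c (clamp 0 1 x)\<bar> \<le> exp (- \<tau>) * dist b c"
        by (intro T_dist bc clamp) (metis dist_bounded dist_real_def)
      then show "dist (F b x) (F c x) \<le> exp (- \<tau>) * dist b c"
        by (simp add: F dist_real_def)
    qed
  qed
  then obtain b where "F b = b" by blast
  define u where "u = restrict b {0..1}"
  have u: "u \<in> C01"
    using bc[of "{0..1}" b] by (auto simp: u_def C01_def cong: continuous_on_cong_simp)
  have "u t = T u t" if t: "t \<in> {0..1}" for t
  proof -
    have "u t = T b (clamp 0 1 t)" using F[of b t] \<open>F b = b\<close> t by (simp add: u_def)
    also have "\<dots> = T b t" using t clamp_cancel_cbox[of t 0 1] by simp
    also have "\<dots> = T u t" using t by (intro T_cong) (auto simp: u_def)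
    finally show ?thesis .
  qed
  then have sol: "bvp_solution f u"
    using bvp_solution_iff_green_op[OF assms(1,2) u] by (simp add: T_def)
  show ?thesis
  proof (rule ex1I[of _ u])
    fix v assume v_sol: "bvp_solution f v"
    then have v: "v \<in> C01" by (simp add: bvp_solution_def)
    have fix_T: "u t = T u t" "v t = T v t" if "t \<in> {0..1}" for t
      using sol v_sol bvp_solution_iff_green_op[OF assms(1,2)] u v that by (auto simp: T_def)
    \<comment> \<open>Uniqueness is argued directly in \<open>C01\<close>: two fixed points at
      supremum distance \<open>?M\<close> satisfy \<open>?M \<le> exp (- \<tau>) * ?M\<close>, which
      forces \<open>?M \<le> 0\<close>.\<close>
    let ?M = "SUP t\<in>{0..1}. \<bar>u t - v t\<bar>"
    have "\<bar>u t - v t\<bar> \<le> exp (- \<tau>) * ?M" if "t \<in> {0..1}" for t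
    proof -
      have "\<bar>T u t - T v t\<bar> \<le> exp (- \<tau>) * ?M"
        using u v that by (intro T_dist C01_diff_le_SUP) (auto simp: C01_def)
      then show ?thesis using fix_T[OF that] by simp
    qed
    then have "?M \<le> exp (- \<tau>) * ?M" by (intro cSUP_least) auto
    then have "(1 - exp (- \<tau>)) * ?M \<le> 0" by (simp add: algebra_simps)
    then have "?M \<le> 0" using \<open>\<tau> > 0\<close> by (simp add: mult_le_0_iff)
    then have "v t = u t" if "t \<in> {0..1}" for t
      using C01_diff_le_SUP[OF u v that] by simp
    then show "v = u"
      using u v by (intro extensionalityI[of v "{0..1}" u]) (auto simp: C01_def)
  qed (fact sol)
qed

end
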